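(* Let $k>0$. Let $D\subset\mathbb R^2$ be a bounded convex region with a smooth boundary except for a straight corner at the point $p\in\partial D$, and suppose it has a constant refractive index $0<q\neq1$. Let $u^{\mathrm{in}}$ be an incident wave with wave number $k$ such that $u^{\mathrm{in}}(p)\neq0$. Then $u^{\mathrm{in}}$ is scattered by $D$.
   Context: A straight corner at $p$ means that near $p$ the boundary $\partial D$ consists of two line segments meeting at $p$ with interior angle $2\theta$, $\theta\in(0,\pi/2)$. An incident wave with wave number $k>0$ is a non-trivial solution $u^{\mathrm{in}}$ of $\Delta u^{\mathrm{in}}+k^2u^{\mathrm{in}}=0$ in $\mathbb R^2$. For a bounded simply connected planar domain $D$ with constant refractive index $q$ (the index is $1$ outside $D$), $u^{\mathrm{in}}$ is called nonscattering for $D$ if there is $u\in H^2_{\mathrm{loc}}(\mathbb R^2)$ with $u=0$ in $\mathbb R^2\setminus D$ and $\Delta u+k^2qu=k^2(1-q)u^{\mathrm{in}}\chi_D$ in $\mathbb R^2$, where $\chi_D$ is the indicator function of $D$ (here $u$ is the total field minus $u^{\mathrm{in}}$). Otherwise $u^{\mathrm{in}}$ is said to be scattered by $D$. *)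

theory Defs
  imports "HOL-Analysis.Analysis"
begin

section \<open>Classical derivatives\<close>

definition partial_deriv ::
  "'a::euclidean_space \<Rightarrow> ('a \<Rightarrow> 'b::real_normed_vector) \<Rightarrow> 'a \<Rightarrow> 'b" where
  "partial_deriv b f x = frechet_derivative f (at x) b"

primrec C_k :: "nat \<Rightarrow> ('a::euclidean_space \<Rightarrow> 'b::real_normed_vector) \<Rightarrow> bool" where
  "C_k 0 f \<longleftrightarrow> continuous_on UNIV f"
| "C_k (Suc n) f \<longleftrightarrow> (\<forall>x. f differentiable (at x)) \<and> (\<forall>b\<in>Basis. C_k n (partial_deriv b f))"

definition smooth :: "('a::euclidean_space \<Rightarrow> 'b::real_normed_vector) \<Rightarrow> bool" where
  "smooth f \<longleftrightarrow> (\<forall>n. C_k n f)"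

definition laplacian :: "('a::euclidean_space \<Rightarrow> 'b::real_normed_vector) \<Rightarrow> 'a \<Rightarrow> 'b" where
  "laplacian f x = (\<Sum>b\<in>Basis. partial_deriv b (partial_deriv b f) x)"


section \<open>Weak derivatives and local Sobolev spaces\<close>

definition test_function :: "('a::euclidean_space \<Rightarrow> real) \<Rightarrow> bool" where
  "test_function \<phi> \<longleftrightarrow> smooth \<phi> \<and> compact (closure {x. \<phi> x \<noteq> 0})"

definition L1_loc :: "('a::euclidean_space \<Rightarrow> complex) \<Rightarrow> bool" where
  "L1_loc f \<longleftrightarrow> (\<forall>K. compact K \<longrightarrow> set_integrable lebesgue K f)"

definition L2_loc :: "('a::euclidean_space \<Rightarrow> complex) \<Rightarrow> bool" where
  "L2_loc f \<longleftrightarrow> f \<in> borel_measurable lebesgue \<and>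
     (\<forall>K. compact K \<longrightarrow> set_integrable lebesgue K (\<lambda>x. (norm (f x))\<^sup>2))"

text \<open>Local integrability is part of the notion, so that both integrals below exist.
  Real-valued test functions suffice by linearity.\<close>

definition has_weak_partial ::
  "'a::euclidean_space \<Rightarrow> ('a \<Rightarrow> complex) \<Rightarrow> ('a \<Rightarrow> complex) \<Rightarrow> bool" where
  "has_weak_partial b u v \<longleftrightarrow> L1_loc u \<and> L1_loc v \<and>
     (\<forall>\<phi>. test_function \<phi> \<longrightarrow>
        (\<integral>x. partial_deriv b \<phi> x *\<^sub>R u x \<partial>lebesgue) = - (\<integral>x. \<phi> x *\<^sub>R v x \<partial>lebesgue))"

text \<open>\<open>H_loc m\<close> is the space usually written $H^m_{\mathrm{loc}}$ over the whole space;
  its members are functions, not classes modulo null sets.\<close>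

primrec H_loc :: "nat \<Rightarrow> ('a::euclidean_space \<Rightarrow> complex) \<Rightarrow> bool" where
  "H_loc 0 u \<longleftrightarrow> L2_loc u"
| "H_loc (Suc m) u \<longleftrightarrow> L2_loc u \<and> (\<forall>b\<in>Basis. \<exists>v. has_weak_partial b u v \<and> H_loc m v)"

definition has_weak_laplacian ::
  "('a::euclidean_space \<Rightarrow> complex) \<Rightarrow> ('a \<Rightarrow> complex) \<Rightarrow> bool" where
  "has_weak_laplacian u w \<longleftrightarrow>
     (\<exists>G H. (\<forall>b\<in>Basis. has_weak_partial b u (G b) \<and> has_weak_partial b (G b) (H b)) \<and>
            (\<forall>x. w x = (\<Sum>b\<in>Basis. H b x)))"


section \<open>Scattering\<close>

text \<open>Solutions of the Helmholtz equation are real-analytic, so nothing is lost by using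
  classical solutions, for which the value at a point makes sense.\<close>

definition incident_wave :: "real \<Rightarrow> (real^2 \<Rightarrow> complex) \<Rightarrow> bool" where
  "incident_wave k uin \<longleftrightarrow> C_k 2 uin \<and>
     (\<forall>x. laplacian uin x + (of_real k)\<^sup>2 * uin x = 0) \<and> (\<exists>x. uin x \<noteq> 0)"

definition nonscattering ::
  "real \<Rightarrow> real \<Rightarrow> (real^2) set \<Rightarrow> (real^2 \<Rightarrow> complex) \<Rightarrow> bool" where
  "nonscattering k q D uin \<longleftrightarrow>
     (\<exists>u Lu. H_loc 2 u \<and> (AE x in lebesgue. x \<notin> D \<longrightarrow> u x = 0) \<and>
        has_weak_laplacian u Lu \<and>
        (AE x in lebesgue. Lu x + of_real (k\<^sup>2 * q) * u x
            = of_real (k\<^sup>2 * (1 - q)) * uin x * indicator D x))"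

definition scattered ::
  "real \<Rightarrow> real \<Rightarrow> (real^2) set \<Rightarrow> (real^2 \<Rightarrow> complex) \<Rightarrow> bool" where
  "scattered k q D uin \<longleftrightarrow> \<not> nonscattering k q D uin"


section \<open>Boundary regularity\<close>

text \<open>Near \<open>x\<close>, in the orthonormal frame \<open>(\<tau>, \<nu>)\<close> based at \<open>x\<close>, the set \<open>D\<close> is the part of a
  disc strictly above the graph of a smooth function.\<close>

definition smooth_boundary_at :: "(real^2) set \<Rightarrow> real^2 \<Rightarrow> bool" where
  "smooth_boundary_at D x \<longleftrightarrow>
     (\<exists>r>0. \<exists>\<tau> \<nu>. \<exists>\<gamma>::real \<Rightarrow> real.
        norm \<tau> = 1 \<and> norm \<nu> = 1 \<and> \<tau> \<bullet> \<nu> = 0 \<and> smooth \<gamma> \<and>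
        D \<inter> ball x r = {y \<in> ball x r. (y - x) \<bullet> \<nu> > \<gamma> ((y - x) \<bullet> \<tau>)})"

text \<open>The unit vectors \<open>a\<close>, \<open>b\<close> point along the two boundary segments and enclose the angle
  \<open>2 * \<theta>\<close>; the last conjunct says that this is the angle on the side of \<open>D\<close>.\<close>

definition straight_corner_at :: "(real^2) set \<Rightarrow> real^2 \<Rightarrow> bool" where
  "straight_corner_at D p \<longleftrightarrow>
     (\<exists>r>0. \<exists>\<theta>\<in>{0<..<pi/2}. \<exists>a b.
        norm a = 1 \<and> norm b = 1 \<and> a \<bullet> b = cos (2 * \<theta>) \<and>
        frontier D \<inter> ball p r =
          (closed_segment p (p + r *\<^sub>R a) \<union> closed_segment p (p + r *\<^sub>R b)) \<inter> ball p r \<and>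
        D \<inter> ball p r = {p + s *\<^sub>R a + t *\<^sub>R b |s t. s > 0 \<and> t > 0} \<inter> ball p r)"

end

theory Submission
  imports Defs
begin

text \<open>If \<open>uin\<close> is nonscattering, testing the equation for \<open>u\<close> against an exact solution
  \<open>w = exp (\<zeta> (x - p))\<close>, \<open>\<zeta> \<bullet> \<zeta> = - k\<^sup>2 * q\<close>, of the interior equation gives \<open>\<integral>\<^sub>D uin * w = 0\<close>;
  a cutoff of \<open>w\<close> is harmless since \<open>u\<close> vanishes outside the bounded set \<open>D\<close>.
  By convexity \<open>D\<close> lies in the cone spanned by the corner, where \<open>w\<close> decays at rate \<open>n\<close> if the
  real part of \<open>\<zeta>\<close> is \<open>- n\<close> times the unit bisector. Blowing up at \<open>p\<close> with factor \<open>n\<close> and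
  letting \<open>n \<longrightarrow> \<infinity>\<close>, the integral tends (up to a fixed Jacobian) to \<open>uin p\<close> times the
  Laplace transform of the quadrant at \<open>(\<alpha>, \<beta>)\<close>, \<open>\<alpha> = exp (\<i> * \<theta>)\<close>, \<open>\<beta> = cnj \<alpha>\<close>, which is
  \<open>1 / (\<alpha> * \<beta>) = 1\<close>. Hence \<open>uin p = 0\<close>.\<close>

subsection \<open>Smooth functions and cutoffs\<close>

lemma partial_deriv_eq:
  assumes "(f has_derivative f') (at x)"
  shows "partial_deriv b f x = f' b"
  using frechet_derivative_at[OF assms] by (simp add: partial_deriv_def)

text \<open>Derivatives are unique, so any explicit \<open>f'\<close> may stand in for
  \<open>frechet_derivative\<close>; the inductions on the order below go through this rule.\<close>

lemma C_k_SucI: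
  assumes "\<And>x. (f has_derivative f' x) (at x)"
    and "\<And>b. b \<in> Basis \<Longrightarrow> C_k n (\<lambda>x. f' x b)"
  shows "C_k (Suc n) f"
proof -
  have "partial_deriv b f = (\<lambda>x. f' x b)" for b
    using partial_deriv_eq[OF assms(1)] by blast
  with assms show ?thesis by (auto simp: differentiable_def)
qed

lemma C_k_Suc_has_derivative:
  assumes "C_k (Suc n) f"
  shows "(f has_derivative (\<lambda>h. frechet_derivative f (at x) h)) (at x)"
  using assms frechet_derivative_works by auto

lemma C_k_Suc_partial:
  assumes "C_k (Suc n) f" "b \<in> Basis"
  shows "C_k n (\<lambda>x. frechet_derivative f (at x) b)"
  using assms by (auto simp: partial_deriv_def[abs_def])

lemma C_k_SucD: "C_k (Suc n) f \<Longrightarrow> C_k n f"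
  by (induction n arbitrary: f)
    (auto simp: continuous_on_eq_continuous_at intro: differentiable_imp_continuous_within)

lemma C_k_imp_continuous: "C_k n f \<Longrightarrow> continuous_on UNIV f"
proof (induction n)
  case (Suc n)
  then show ?case using C_k_SucD by blast
qed simp

lemma smooth_imp_continuous: "smooth f \<Longrightarrow> continuous_on UNIV f"
  using C_k_imp_continuous by (auto simp: smooth_def)

lemma smooth_differentiable: "smooth f \<Longrightarrow> f differentiable (at x)"
  unfolding smooth_def by (metis C_k.simps(2))

lemma smooth_partial_deriv: "smooth f \<Longrightarrow> b \<in> Basis \<Longrightarrow> smooth (partial_deriv b f)"
  unfolding smooth_def by (metis C_k.simps(2))

section \<open>Closure properties of \<open>C_k\<close>\<close>

lemma C_k_const: "C_k n (\<lambda>x. c)"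
proof (induction n arbitrary: c)
  case (Suc n)
  show ?case by (rule C_k_SucI[OF has_derivative_const]) (rule Suc)
qed simp

lemma C_k_add:
  assumes "C_k n f" "C_k n g"
  shows "C_k n (\<lambda>x. f x + g x)"
  using assms
proof (induction n arbitrary: f g)
  case (Suc n)
  note d = C_k_Suc_has_derivative[OF Suc.prems(1)] C_k_Suc_has_derivative[OF Suc.prems(2)]
  show ?case
    by (rule C_k_SucI[OF has_derivative_add[OF d]])
      (intro Suc.IH C_k_Suc_partial Suc.prems)
qed (auto intro!: continuous_on_add continuous_on_mult continuous_on_inverse)

lemma C_k_bounded_linear:
  assumes "bounded_linear T" "C_k n f"
  shows "C_k n (\<lambda>x. T (f x))"
  using assms(2)
proof (induction n arbitrary: f)
  case 0
  then show ?case
    using bounded_linear.continuous_on[OF assms(1)] by auto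
next
  case (Suc n)
  show ?case
    by (rule C_k_SucI[OF bounded_linear.has_derivative[OF assms(1) C_k_Suc_has_derivative[OF Suc.prems]]])
      (intro Suc.IH C_k_Suc_partial Suc.prems)
qed

lemma C_k_mult:
  fixes f g :: "'a::euclidean_space \<Rightarrow> 'b::real_normed_algebra"
  assumes "C_k n f" "C_k n g"
  shows "C_k n (\<lambda>x. f x * g x)"
  using assms
proof (induction n arbitrary: f g)
  case (Suc n)
  note d = C_k_Suc_has_derivative[OF Suc.prems(1)] C_k_Suc_has_derivative[OF Suc.prems(2)]
  \<comment> \<open>Each summand of the product rule keeps one factor undifferentiated; its order
    \<open>Suc n\<close> is lowered to \<open>n\<close> by \<open>C_k_SucD\<close>.\<close>
  show ?case
    by (rule C_k_SucI[OF has_derivative_mult[OF d]])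
      (intro C_k_add Suc.IH C_k_Suc_partial C_k_SucD[OF Suc.prems(1)] C_k_SucD[OF Suc.prems(2)] Suc.prems)
qed (auto intro!: continuous_on_add continuous_on_mult continuous_on_inverse)

lemma C_k_linear:
  assumes "bounded_linear T"
  shows "C_k n T"
proof (cases n)
  case 0
  then show ?thesis using linear_continuous_on[OF assms] by simp
next
  case (Suc m)
  show ?thesis unfolding Suc
    by (rule C_k_SucI[OF bounded_linear_imp_has_derivative[OF assms]]) (rule C_k_const)
qed

lemma C_k_inner_self: "C_k n (\<lambda>x::'a::euclidean_space. x \<bullet> x)"
proof (cases n)
  case 0
  then show ?thesis by (simp add: continuous_intros)
next
  case (Suc m)
  have "C_k m (\<lambda>x::'a. x \<bullet> b + b \<bullet> x)" for b
    by (intro C_k_add C_k_linear bounded_linear_inner_left bounded_linear_inner_right)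
  then show ?thesis unfolding Suc
    by (rule C_k_SucI[OF has_derivative_inner[OF has_derivative_ident has_derivative_ident]])
qed

text \<open>The chain rule replaces \<open>h\<close> by its derivative and keeps \<open>g\<close>
  inside, so the induction generalises over \<open>h\<close> only.\<close>

lemma C_k_compose:
  fixes h :: "real \<Rightarrow> real" and g :: "'a::euclidean_space \<Rightarrow> real"
  assumes "C_k n h" "C_k n g"
  shows "C_k n (\<lambda>x. h (g x))"
  using assms
proof (induction n arbitrary: h)
  case 0
  then show ?case by (auto intro: continuous_on_compose2)
next
  case (Suc n)
  have h: "(h has_real_derivative partial_deriv 1 h t) (at t)" for t
  proof -
    obtain d where d: "(h has_real_derivative d) (at t)"
      using Suc.prems(1) by (auto simp: real_differentiable_def)
    moreover have "partial_deriv 1 h t = d"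
      using partial_deriv_eq[OF d[unfolded has_field_derivative_def]] by simp
    ultimately show ?thesis by simp
  qed
  have "((\<lambda>x. h (g x)) has_derivative
      (\<lambda>y. frechet_derivative g (at x) y * partial_deriv 1 h (g x))) (at x)" for x
    using DERIV_compose_FDERIV[OF h C_k_Suc_has_derivative[OF Suc.prems(2)]] .
  then show ?case
  proof (rule C_k_SucI)
    fix b :: 'a assume b: "b \<in> Basis"
    have "C_k n (partial_deriv 1 h)" using Suc.prems(1) by simp
    then have "C_k n (\<lambda>x. partial_deriv 1 h (g x))"
      by (rule Suc.IH[OF _ C_k_SucD[OF Suc.prems(2)]])
    then show "C_k n (\<lambda>x. frechet_derivative g (at x) b * partial_deriv 1 h (g x))"
      by (rule C_k_mult[OF C_k_Suc_partial[OF Suc.prems(2) b]])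
  qed
qed

text \<open>The derivative of 1/f is a polynomial in 1/f and the derivative of \<open>f\<close>, so
  order \<open>n\<close> of 1/f yields order \<open>Suc n\<close>.\<close>

lemma C_k_inverse:
  fixes f :: "'a::euclidean_space \<Rightarrow> real"
  assumes "C_k n f" "\<And>x. f x \<noteq> 0"
  shows "C_k n (\<lambda>x. inverse (f x))"
  using assms
proof (induction n)
  case 0
  then show ?case by (auto intro!: continuous_on_add continuous_on_mult continuous_on_inverse)
next
  case (Suc n)
  note d = Deriv.has_derivative_inverse[OF Suc.prems(2) C_k_Suc_has_derivative[OF Suc.prems(1)]]
  have "C_k n (\<lambda>x. inverse (f x))"
    using Suc by (simp add: C_k_SucD del: C_k.simps)
  then have "C_k n (\<lambda>x. - (inverse (f x) * frechet_derivative f (at x) b * inverse (f x)))"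
    if "b \<in> Basis" for b
    using that
    by (intro C_k_bounded_linear[OF bounded_linear_minus[OF bounded_linear_ident]] C_k_mult
        C_k_Suc_partial Suc.prems)
  then show ?case by (rule C_k_SucI[OF d])
qed

section \<open>Flat functions and smooth cutoffs\<close>

lemma tendsto_power_exp_inverse_right_0:
  "((\<lambda>t::real. (1 / t) ^ k * exp (- (1 / t))) \<longlongrightarrow> 0) (at_right 0)"
proof -
  have "((\<lambda>t::real. inverse t ^ k / exp (inverse t)) \<longlongrightarrow> 0) (at_right 0)"
    by (rule filterlim_compose[OF tendsto_power_div_exp_0 filterlim_inverse_at_top_right])
  then show ?thesis by (simp add: exp_minus field_simps)
qed

text \<open>The classical non-analytic function exp(-1/t), times a power of 1/t. With all powers
  present the family is closed under differentiation up to linear combinations, so smoothness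
  follows by an induction uniform in \<open>k\<close>.\<close>

definition flat :: "nat \<Rightarrow> real \<Rightarrow> real" where
  "flat k t = (if t > 0 then (1 / t) ^ k * exp (- (1 / t)) else 0)"

lemma flat_has_real_derivative:
  "(flat k has_real_derivative (flat (k + 2) t - of_nat k * flat (k + 1) t)) (at t)"
proof -
  consider "t > 0" | "t < 0" | "t = 0" by linarith
  then show ?thesis
  proof cases
    case 1
    have "((\<lambda>t. (1 / t) ^ k * exp (- (1 / t))) has_real_derivative
        (flat (k + 2) t - of_nat k * flat (k + 1) t)) (at t)"
    proof (cases k)
      case 0
      then show ?thesis
        using 1 by (auto intro!: derivative_eq_intros simp: flat_def power2_eq_square)
    next
      case (Suc m)
      have e: "of_nat k * (1 / t) ^ m * (- 1 / t\<^sup>2) * exp (- (1 / t)) + exp (- (1 / t)) * (1 / t\<^sup>2) * (1 / t) ^ k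
          = flat (k + 2) t - of_nat k * flat (k + 1) t"
        using 1 by (simp add: flat_def Suc field_simps power2_eq_square)
      have d1: "((\<lambda>t. (1 / t) ^ k) has_real_derivative of_nat k * (1 / t) ^ m * (- 1 / t\<^sup>2)) (at t)"
      proof -
        have "((\<lambda>t. 1 / t) has_real_derivative - 1 / t\<^sup>2) (at t)"
          using 1 by (auto intro!: derivative_eq_intros simp: power2_eq_square)
        from DERIV_power_Suc[OF this, of m] show ?thesis by (simp add: Suc mult_ac)
      qed
      have d2: "((\<lambda>t. exp (- (1 / t))) has_real_derivative exp (- (1 / t)) * (1 / t\<^sup>2)) (at t)"
        using 1 by (auto intro!: derivative_eq_intros simp: power2_eq_square)
      show ?thesis
        using DERIV_mult[OF d1 d2] unfolding e .
    qed
    then show ?thesis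
      by (rule has_field_derivative_transform_within_open[of _ _ _ "{0<..}"]) (use 1 in \<open>auto simp: flat_def\<close>)
  next
    case 2
    have "((\<lambda>t. 0) has_real_derivative (flat (k + 2) t - of_nat k * flat (k + 1) t)) (at t)"
      using 2 by (simp add: flat_def)
    then show ?thesis
      by (rule has_field_derivative_transform_within_open[of _ _ _ "{..<0}"]) (use 2 in \<open>auto simp: flat_def\<close>)
  next
    case 3
    \<comment> \<open>To the right of 0 the difference quotient at 0 is \<open>flat (Suc k)\<close>;
      to the left it is 0.\<close>
    have "((\<lambda>h. flat k h / h) \<longlongrightarrow> 0) (at_right 0)"
      by (rule Lim_transform_eventually[OF tendsto_power_exp_inverse_right_0[of "Suc k"]])
        (auto simp: eventually_at_filter flat_def)
    moreover have "((\<lambda>h. flat k h / h) \<longlongrightarrow> 0) (at_left 0)"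
      by (rule Lim_transform_eventually[OF tendsto_const]) (auto simp: eventually_at_filter flat_def)
    ultimately have "((\<lambda>h. flat k h / h) \<longlongrightarrow> 0) (at 0)"
      by (simp add: filterlim_split_at)
    then show ?thesis using 3 by (simp add: DERIV_def flat_def)
  qed
qed

lemma C_k_flat: "C_k n (flat k)"
proof (induction n arbitrary: k)
  case 0
  have "isCont (flat k) t" for t
    using flat_has_real_derivative DERIV_isCont by blast
  then show ?case by (simp add: continuous_on_eq_continuous_at)
next
  case (Suc n)
  show ?case
  proof (rule C_k_SucI)
    show "(flat k has_derivative (*) (flat (k + 2) t + (- of_nat k) * flat (k + 1) t)) (at t)" for t
      using flat_has_real_derivative[of k t] by (simp add: has_field_derivative_def)
    show "C_k n (\<lambda>t. (flat (k + 2) t + (- of_nat k) * flat (k + 1) t) * b)" for b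
      by (intro C_k_mult C_k_add C_k_const Suc)
  qed
qed

text \<open>The witness is \<open>flat 0 t\<close> divided by
  \<open>flat 0 t + flat 0 (1 - t)\<close>, which is positive because t or 1 - t is.\<close>

lemma ex_smooth_step:
  obtains h :: "real \<Rightarrow> real" where "smooth h" "\<And>t. t \<le> 0 \<Longrightarrow> h t = 0" "\<And>t. t \<ge> 1 \<Longrightarrow> h t = 1"
proof
  let ?h = "\<lambda>t. flat 0 t * inverse (flat 0 t + flat 0 (1 - t))"
  have pos: "flat 0 t + flat 0 (1 - t) > 0" for t
    by (auto simp: flat_def add_pos_pos)
  have "C_k n (\<lambda>t. flat 0 (1 - t))" for n
    using C_k_compose[OF C_k_flat C_k_add[OF C_k_const C_k_linear[OF bounded_linear_minus[OF bounded_linear_ident]]]]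
    by simp
  then show "smooth ?h"
    unfolding smooth_def using pos[THEN less_imp_neq, symmetric]
    by (intro allI C_k_mult C_k_inverse C_k_add C_k_flat)
  show "?h t = 0" if "t \<le> 0" for t using that by (simp add: flat_def)
  show "?h t = 1" if "t \<ge> 1" for t using that by (simp add: flat_def)
qed

text \<open>A smooth step is applied to R^2 + 1 - |x|^2, which is at least 1 on \<open>S\<close> and
  at most 0 far out; unlike the norm, its square is smooth at the origin.\<close>

lemma ex_smooth_cutoff:
  fixes S :: "'a::euclidean_space set"
  assumes "bounded S"
  obtains \<eta> where "test_function \<eta>" "\<And>x. x \<in> S \<Longrightarrow> \<eta> x = 1"
proof -
  obtain R where R: "\<And>x. x \<in> S \<Longrightarrow> norm x \<le> R"
    using assms by (auto simp: bounded_iff)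
  obtain h :: "real \<Rightarrow> real" where h: "smooth h" "\<And>t. t \<le> 0 \<Longrightarrow> h t = 0" "\<And>t. t \<ge> 1 \<Longrightarrow> h t = 1"
    using ex_smooth_step by metis
  let ?g = "\<lambda>x::'a. (R\<^sup>2 + 1) + - (x \<bullet> x)"
  have "C_k n ?g" for n
    by (rule C_k_add[OF C_k_const C_k_bounded_linear[OF bounded_linear_minus[OF bounded_linear_ident] C_k_inner_self]])
  then have "smooth (\<lambda>x. h (?g x))"
    using h(1) C_k_compose unfolding smooth_def by blast
  moreover have "compact (closure {x. h (?g x) \<noteq> 0})"
  proof -
    have "norm x \<le> sqrt (R\<^sup>2 + 1)" if "h (?g x) \<noteq> 0" for x
      using h(2)[of "?g x"] that by (intro real_le_rsqrt) (force simp: power2_norm_eq_inner)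
    then show ?thesis by (auto simp: compact_closure bounded_iff)
  qed
  moreover have "h (?g x) = 1" if "x \<in> S" for x
    using power_mono[OF R[OF that] norm_ge_zero, of 2] by (intro h(3)) (simp add: power2_norm_eq_inner)
  ultimately show thesis
    by (intro that[of "\<lambda>x. h (?g x)"]) (auto simp: test_function_def)
qed

subsection \<open>Testing the weak Laplacian\<close>

text \<open>Comparison with \<open>f\<close> cut off to the support of \<open>\<phi>\<close>, on
  which the continuous \<open>\<phi>\<close> is bounded.\<close>

lemma L1_loc_integrable_scaleR:
  fixes f :: "'a::euclidean_space \<Rightarrow> complex"
  assumes "L1_loc f" "continuous_on UNIV \<phi>" "compact (closure {x. \<phi> x \<noteq> 0})"
  shows "integrable lebesgue (\<lambda>x. \<phi> x *\<^sub>R f x)"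
proof -
  let ?K = "closure {x. \<phi> x \<noteq> 0}"
  obtain M where M: "\<And>x. x \<in> ?K \<Longrightarrow> \<bar>\<phi> x\<bar> \<le> M"
    using compact_imp_bounded[OF compact_continuous_image[OF continuous_on_subset[OF assms(2)] assms(3)]]
    by (auto simp: bounded_iff)
  have int: "integrable lebesgue (\<lambda>x. indicator ?K x *\<^sub>R f x)"
    using assms(1,3) by (simp add: L1_loc_def set_integrable_def)
  \<comment> \<open>The indicator also supplies measurability, since \<open>L1_loc\<close> speaks of
    \<open>f\<close> only after cutting off to compact sets.\<close>
  have eq: "\<phi> x *\<^sub>R f x = \<phi> x *\<^sub>R (indicator ?K x *\<^sub>R f x)" for x
    using closure_subset[of "{x. \<phi> x \<noteq> 0}"] by (auto split: split_indicator)
  have meas: "\<phi> \<in> borel_measurable lebesgue"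
    by (intro measurable_completion) (simp add: assms(2) borel_measurable_continuous_onI)
  show ?thesis
  proof (rule Bochner_Integration.integrable_bound)
    show "integrable lebesgue (\<lambda>x. M *\<^sub>R (indicator ?K x *\<^sub>R f x))"
      using int by (rule integrable_scaleR_right)
    show "(\<lambda>x. \<phi> x *\<^sub>R f x) \<in> borel_measurable lebesgue"
      unfolding eq by (rule borel_measurable_scaleR[OF meas borel_measurable_integrable[OF int]])
    show "AE x in lebesgue. norm (\<phi> x *\<^sub>R f x) \<le> norm (M *\<^sub>R (indicator ?K x *\<^sub>R f x))"
    proof (rule AE_I2)
      fix x
      show "norm (\<phi> x *\<^sub>R f x) \<le> norm (M *\<^sub>R (indicator ?K x *\<^sub>R f x))"
        using M[of x] unfolding eq
        by (auto split: split_indicator intro!: mult_right_mono)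
    qed
  qed
qed

lemma test_function_integrable:
  "L1_loc f \<Longrightarrow> test_function \<phi> \<Longrightarrow> integrable lebesgue (\<lambda>x. \<phi> x *\<^sub>R f x)"
  by (rule L1_loc_integrable_scaleR) (auto simp: test_function_def smooth_imp_continuous)

lemma partial_deriv_cong_open:
  assumes "open X" "x \<in> X" "f differentiable (at x)" "\<And>y. y \<in> X \<Longrightarrow> f y = g y"
  shows "partial_deriv b f x = partial_deriv b g x"
  unfolding partial_deriv_def by (subst frechet_derivative_transform_within_open[OF assms(3,1,2,4)]) auto

lemma compact_closure_support_subset:
  assumes "compact (closure {x. f x \<noteq> 0})" "\<And>x. x \<notin> closure {x. f x \<noteq> 0} \<Longrightarrow> g x = 0"
  shows "compact (closure {x. g x \<noteq> 0})"
proof -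
  have "closure {x. g x \<noteq> 0} \<subseteq> closure {x. f x \<noteq> 0}"
    using assms(2) by (intro closure_minimal) auto
  then show ?thesis
    using compact_Int_closed[OF assms(1) closed_closure, of "{x. g x \<noteq> 0}"]
    by (simp add: inf.absorb2)
qed

text \<open>Off its closed support \<open>\<phi>\<close> vanishes on an open set, hence so does its
  derivative: supports do not grow.\<close>

lemma test_function_partial_deriv:
  assumes "test_function \<phi>" "b \<in> Basis"
  shows "test_function (partial_deriv b \<phi>)"
proof -
  have 0: "partial_deriv b \<phi> x = 0" if "x \<notin> closure {x. \<phi> x \<noteq> 0}" for x
  proof -
    have "partial_deriv b \<phi> x = partial_deriv b (\<lambda>_. 0) x"
      using assms that closure_subset[of "{x. \<phi> x \<noteq> 0}"]
      by (intro partial_deriv_cong_open[of "- closure {x. \<phi> x \<noteq> 0}"])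
        (auto simp: test_function_def smooth_differentiable)
    then show ?thesis by (simp add: partial_deriv_def)
  qed
  show ?thesis
    using assms smooth_partial_deriv compact_closure_support_subset[of \<phi> "partial_deriv b \<phi>", OF _ 0]
    unfolding test_function_def by blast
qed

text \<open>Two weak integrations by parts per coordinate, first with
  \<open>partial_deriv b \<phi>\<close> and then with \<open>\<phi>\<close> as test function; the
  two signs cancel. Integrability is recorded because the two integrals are subtracted
  later.\<close>

lemma weak_laplacian_test_function:
  assumes "has_weak_laplacian u Lu" "test_function \<phi>"
  shows "integrable lebesgue (\<lambda>x. laplacian \<phi> x *\<^sub>R u x)"
    and "integrable lebesgue (\<lambda>x. \<phi> x *\<^sub>R Lu x)"
    and "(\<integral>x. laplacian \<phi> x *\<^sub>R u x \<partial>lebesgue) = (\<integral>x. \<phi> x *\<^sub>R Lu x \<partial>lebesgue)"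
proof -
  obtain G H where G: "\<And>b. b \<in> Basis \<Longrightarrow> has_weak_partial b u (G b)"
    and H: "\<And>b. b \<in> Basis \<Longrightarrow> has_weak_partial b (G b) (H b)"
    and Lu: "\<And>x. Lu x = (\<Sum>b\<in>Basis. H b x)"
    using assms(1) unfolding has_weak_laplacian_def by metis
  let ?d = "\<lambda>b. partial_deriv b (partial_deriv b \<phi>)"
  have t: "test_function (partial_deriv b \<phi>)" "test_function (?d b)" if "b \<in> Basis" for b
    using that assms(2) test_function_partial_deriv by blast+
  have iu: "integrable lebesgue (\<lambda>x. ?d b x *\<^sub>R u x)" and iH: "integrable lebesgue (\<lambda>x. \<phi> x *\<^sub>R H b x)"
    if "b \<in> Basis" for b
    using that G H t assms(2) by (auto intro!: test_function_integrable simp: has_weak_partial_def)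
  have eq: "(\<integral>x. ?d b x *\<^sub>R u x \<partial>lebesgue) = (\<integral>x. \<phi> x *\<^sub>R H b x \<partial>lebesgue)" if "b \<in> Basis" for b
    using G[OF that] H[OF that] t(1)[OF that] assms(2) by (simp add: has_weak_partial_def)
  have L: "laplacian \<phi> x *\<^sub>R u x = (\<Sum>b\<in>Basis. ?d b x *\<^sub>R u x)" for x
    by (simp add: laplacian_def scaleR_left.sum)
  have R: "\<phi> x *\<^sub>R Lu x = (\<Sum>b\<in>Basis. \<phi> x *\<^sub>R H b x)" for x
    by (simp add: Lu scaleR_right.sum)
  show "integrable lebesgue (\<lambda>x. laplacian \<phi> x *\<^sub>R u x)" "integrable lebesgue (\<lambda>x. \<phi> x *\<^sub>R Lu x)"
    unfolding L R using iu iH by (auto intro!: Bochner_Integration.integrable_sum)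
  show "(\<integral>x. laplacian \<phi> x *\<^sub>R u x \<partial>lebesgue) = (\<integral>x. \<phi> x *\<^sub>R Lu x \<partial>lebesgue)"
    unfolding L R using iu iH eq by (simp add: Bochner_Integration.integral_sum)
qed

lemma laplacian_cong_open:
  assumes "open X" "x \<in> X" "smooth f" "\<And>y. y \<in> X \<Longrightarrow> f y = g y"
  shows "laplacian f x = laplacian g x"
  unfolding laplacian_def
proof (rule sum.cong[OF refl])
  fix b :: 'a assume b: "b \<in> Basis"
  show "partial_deriv b (partial_deriv b f) x = partial_deriv b (partial_deriv b g) x"
    using assms b
    by (intro partial_deriv_cong_open[OF assms(1,2)])
      (auto intro!: smooth_differentiable smooth_partial_deriv partial_deriv_cong_open[OF assms(1)])
qed

lemma partial_deriv_bounded_linear: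
  assumes "bounded_linear T" "f differentiable (at x)"
  shows "partial_deriv b (\<lambda>x. T (f x)) x = T (partial_deriv b f x)"
  using partial_deriv_eq[OF bounded_linear.has_derivative[OF assms(1) frechet_derivative_works[THEN iffD1, OF assms(2)]]]
  by (simp add: partial_deriv_def)

text \<open>Meant for \<open>T\<close> = \<open>Re\<close> and \<open>T\<close> = \<open>Im\<close>,
  to split a complex solution into two real ones.\<close>

lemma laplacian_bounded_linear:
  assumes "bounded_linear T" "smooth f"
  shows "laplacian (\<lambda>x. T (f x)) x = T (laplacian f x)"
proof -
  have "partial_deriv b (\<lambda>x. T (f x)) = (\<lambda>x. T (partial_deriv b f x))" for b
    using partial_deriv_bounded_linear[OF assms(1) smooth_differentiable[OF assms(2)]] by blast
  then show ?thesis
    using assms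
    by (simp add: laplacian_def partial_deriv_bounded_linear smooth_differentiable smooth_partial_deriv
        linear_sum bounded_linear.linear)
qed

lemma ex_test_function_extension:
  assumes "bounded D" "smooth f"
  obtains \<phi> where "test_function \<phi>" "\<And>x. x \<in> D \<Longrightarrow> \<phi> x = f x"
proof -
  obtain \<eta> where \<eta>: "test_function \<eta>" "\<And>x. x \<in> D \<Longrightarrow> \<eta> x = 1"
    using ex_smooth_cutoff[OF assms(1)] by blast
  have "smooth (\<lambda>x. \<eta> x * f x)"
    using \<eta>(1) assms(2) by (simp add: test_function_def smooth_def C_k_mult)
  moreover have "compact (closure {x. \<eta> x * f x \<noteq> 0})"
  proof (rule compact_closure_support_subset)
    show "compact (closure {x. \<eta> x \<noteq> 0})" using \<eta>(1) unfolding test_function_def by blast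
    show "\<eta> x * f x = 0" if "x \<notin> closure {x. \<eta> x \<noteq> 0}" for x
    proof -
      have "\<eta> x = 0" using that closure_subset[of "{x. \<eta> x \<noteq> 0}"] by blast
      then show ?thesis by simp
    qed
  qed
  ultimately show thesis
    using \<eta>(2) by (intro that[of "\<lambda>x. \<eta> x * f x"]) (auto simp: test_function_def)
qed

text \<open>Green's identity without boundary terms, as \<open>u\<close> vanishes outside
  \<open>D\<close>. With \<open>\<phi>\<close> a test function equal to \<open>f\<close> on
  \<open>D\<close>, the integrand \<phi> Lu - (Laplacian of \<phi>) u is f (Lu + c u) = f g on
  \<open>D\<close>, and almost everywhere 0 outside, where \<open>u\<close> and hence
  \<open>Lu\<close> vanish. Test functions being real, real \<open>f\<close> comes first.\<close>

lemma integral_helmholtz_real: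
  fixes f :: "'a::euclidean_space \<Rightarrow> real" and c d :: real
  assumes D: "open D" "bounded D" and L: "has_weak_laplacian u Lu"
    and u: "AE x in lebesgue. x \<notin> D \<longrightarrow> u x = 0"
    and eq: "AE x in lebesgue. Lu x + of_real c * u x = g x * indicator D x"
    and g: "continuous_on UNIV g"
    and f: "smooth f" "\<And>x. laplacian f x = - c * f x"
  shows "has_bochner_integral lebesgue (\<lambda>x. of_real (f x) * (g x * indicator D x)) 0"
proof -
  obtain \<phi> where \<phi>: "test_function \<phi>" "\<And>x. x \<in> D \<Longrightarrow> \<phi> x = f x"
    using ex_test_function_extension[OF D(2) f(1)] by blast
  note w = weak_laplacian_test_function[OF L \<phi>(1)]
  \<comment> \<open>Openness of \<open>D\<close> matters here: the Laplacians of
    \<open>\<phi>\<close> and \<open>f\<close> agree wherever the functions agree nearby.\<close>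
  have lap: "laplacian \<phi> x = - c * \<phi> x" if "x \<in> D" for x
    using laplacian_cong_open[OF D(1) that, of \<phi> f] \<phi> f that by (simp add: test_function_def)
  have I: "has_bochner_integral lebesgue (\<lambda>x. \<phi> x *\<^sub>R Lu x - laplacian \<phi> x *\<^sub>R u x) 0"
    using has_bochner_integral_diff[OF has_bochner_integral_integrable[OF w(2)] has_bochner_integral_integrable[OF w(1)]]
    by (simp add: w(3))
  have ae: "AE x in lebesgue. \<phi> x *\<^sub>R Lu x - laplacian \<phi> x *\<^sub>R u x = of_real (f x) * (g x * indicator D x)"
    using u eq
  proof eventually_elim
    case (elim x)
    have Lu: "Lu x = g x * indicator D x - of_real c * u x"
      using elim(2) by (simp add: algebra_simps)
    show ?case
      using elim(1) lap[of x] \<phi>(2)[of x] unfolding Lu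
      by (cases "x \<in> D") (simp_all add: scaleR_conv_of_real algebra_simps)
  qed
  have meas: "(\<lambda>x. of_real (f x) * (g x * indicator D x)) \<in> borel_measurable lebesgue"
    using D(1) g smooth_imp_continuous[OF f(1)]
    by (intro measurable_completion borel_measurable_times borel_measurable_of_real borel_measurable_indicator')
      (auto intro: borel_measurable_continuous_onI)
  show ?thesis
    using I has_bochner_integral_cong_AE[OF borel_measurable_has_bochner_integral[OF I] meas ae] by blast
qed

lemma integral_helmholtz:
  fixes f :: "'a::euclidean_space \<Rightarrow> complex" and c :: real
  assumes D: "open D" "bounded D" and L: "has_weak_laplacian u Lu"
    and u: "AE x in lebesgue. x \<notin> D \<longrightarrow> u x = 0"
    and eq: "AE x in lebesgue. Lu x + of_real c * u x = g x * indicator D x"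
    and g: "continuous_on UNIV g"
    and f: "smooth f" "\<And>x. laplacian f x = - of_real c * f x"
  shows "has_bochner_integral lebesgue (\<lambda>x. f x * (g x * indicator D x)) 0"
proof -
  \<comment> \<open>\<open>T\<close> is \<open>Re\<close> or \<open>Im\<close>; both commute with
    the real factor -c, so \<open>T\<close> composed with \<open>f\<close> solves the same
    equation.\<close>
  have *: "has_bochner_integral lebesgue (\<lambda>x. of_real (T (f x)) * (g x * indicator D x)) 0"
    if T: "bounded_linear T" "\<And>z. T (- of_real c * z) = - c * T z" for T
  proof (rule integral_helmholtz_real[OF D L u eq g])
    show "smooth (\<lambda>x. T (f x))"
      using f(1) unfolding smooth_def by (intro allI C_k_bounded_linear[OF T(1)]) auto
    show "laplacian (\<lambda>x. T (f x)) x = - c * T (f x)" for x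
      using laplacian_bounded_linear[OF T(1) f(1)] f(2) T(2) by metis
  qed
  have "has_bochner_integral lebesgue (\<lambda>x. of_real (Re (f x)) * (g x * indicator D x)
      + \<i> * (of_real (Im (f x)) * (g x * indicator D x))) (0 + \<i> * 0)"
    by (intro has_bochner_integral_add has_bochner_integral_mult_right *)
      (auto simp: bounded_linear_Re bounded_linear_Im)
  also have "(\<lambda>x. of_real (Re (f x)) * (g x * indicator D x) + \<i> * (of_real (Im (f x)) * (g x * indicator D x)))
      = (\<lambda>x. (of_real (Re (f x)) + \<i> * of_real (Im (f x))) * (g x * indicator D x))"
    by (simp add: algebra_simps)
  finally show ?thesis by (simp flip: complex_eq)
qed

section \<open>Complex exponential solutions\<close>

lemma exp_affine_has_derivative:
  assumes "bounded_linear \<zeta>"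
  shows "((\<lambda>x. exp (\<zeta> (x - p) :: complex)) has_derivative (\<lambda>h. \<zeta> h * exp (\<zeta> (x - p)))) (at x)"
proof -
  have "((\<lambda>x. \<zeta> (x - p)) has_derivative \<zeta>) (at x)"
    by (rule bounded_linear.has_derivative[OF assms]) (auto intro!: derivative_eq_intros)
  from has_derivative_compose[OF this DERIV_exp[unfolded has_field_derivative_def]] show ?thesis
    by (simp add: mult.commute)
qed

lemma smooth_exp_affine:
  assumes "bounded_linear \<zeta>"
  shows "smooth (\<lambda>x. exp (\<zeta> (x - p) :: complex))"
  unfolding smooth_def
proof
  fix n show "C_k n (\<lambda>x. exp (\<zeta> (x - p)))"
  proof (induction n)
    case 0
    show ?case
      using has_derivative_continuous[OF exp_affine_has_derivative[OF assms]]
      by (simp add: continuous_on_eq_continuous_at)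
  next
    case (Suc n)
    show ?case
      by (rule C_k_SucI[OF exp_affine_has_derivative[OF assms]]) (intro C_k_mult C_k_const Suc)
  qed
qed

text \<open>The coefficient is the complex bilinear square of the vector of all
  \<open>\<zeta> b\<close>, without conjugation; it can therefore be made negative while the real
  part of \<open>\<zeta>\<close> is large.\<close>

lemma laplacian_exp_affine:
  assumes "bounded_linear \<zeta>"
  shows "laplacian (\<lambda>x. exp (\<zeta> (x - p) :: complex)) x = (\<Sum>b\<in>Basis. (\<zeta> b)\<^sup>2) * exp (\<zeta> (x - p))"
proof -
  have "partial_deriv b (\<lambda>x. exp (\<zeta> (x - p))) = (\<lambda>x. \<zeta> b * exp (\<zeta> (x - p)))" for b
    using partial_deriv_eq[OF exp_affine_has_derivative[OF assms]] by blast
  moreover have "partial_deriv b (\<lambda>x. \<zeta> b * exp (\<zeta> (x - p))) x = \<zeta> b * (\<zeta> b * exp (\<zeta> (x - p)))" for b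
    by (rule partial_deriv_eq[OF has_derivative_mult_right[OF exp_affine_has_derivative[OF assms]]])
  ultimately show ?thesis
    by (simp add: laplacian_def sum_distrib_right power2_eq_square mult.assoc)
qed

subsection \<open>Linear substitutions and Laplace integrals\<close>

text \<open>A measure with the right values on boxes is \<open>lborel\<close>. The preimage of a box
  under \<open>g\<close> is its image under the inverse \<open>h\<close>, and applying
  \<open>g\<close> to that image multiplies its measure by the absolute determinant.\<close>

lemma density_distr_lborel_linear:
  fixes g :: "real^'n::{finite,wellorder} \<Rightarrow> real^'n::_"
  assumes "linear g" "inj g"
  shows "density (distr lborel borel g) (\<lambda>_. ennreal \<bar>det (matrix g)\<bar>) = lborel"
proof (rule lborel_eqI[symmetric])
  fix l u :: "real^'n::_"
  assume le: "\<And>b. b \<in> Basis \<Longrightarrow> l \<bullet> b \<le> u \<bullet> b"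
  obtain h where h: "linear h" "\<And>x. h (g x) = x" "\<And>x. g (h x) = x"
    using linear_injective_isomorphism[OF assms] by blast
  have g: "g \<in> borel_measurable borel"
    by (intro borel_measurable_continuous_onI linear_continuous_on linear_conv_bounded_linear[THEN iffD1] assms)
  have hb: "g -` box l u = h ` box l u"
    using h by (auto simp: image_iff) metis
  have S: "h ` box l u \<in> lmeasurable"
    by (intro measurable_linear_image h) simp
  have gS: "g ` h ` box l u = box l u"
    using h(3) by (simp add: image_image)
  have borel: "h ` box l u \<in> sets borel"
    using measurable_sets_borel[OF g, of "box l u"] by (simp add: hb)
  have "emeasure (density (distr lborel borel g) (\<lambda>_. ennreal \<bar>det (matrix g)\<bar>)) (box l u)
      = ennreal \<bar>det (matrix g)\<bar> * emeasure lborel (h ` box l u)"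
    using g by (simp add: emeasure_density_const emeasure_distr hb)
  also have "emeasure lborel (h ` box l u) = emeasure lebesgue (h ` box l u)"
    using borel by simp
  also have "\<dots> = ennreal (measure lebesgue (h ` box l u))"
    by (rule emeasure_eq_measure2[OF S])
  also have "ennreal \<bar>det (matrix g)\<bar> * \<dots> = ennreal (measure lebesgue (box l u))"
    using measure_linear_image[OF assms(1) S] by (simp add: gS ennreal_mult')
  also have "\<dots> = (\<Prod>b\<in>Basis. (u - l) \<bullet> b)"
    using le by (simp add: measure_lborel_box)
  finally show "emeasure (density (distr lborel borel g) (\<lambda>_. ennreal \<bar>det (matrix g)\<bar>)) (box l u)
      = ennreal (\<Prod>b\<in>Basis. (u - l) \<bullet> b)" .
qed simp

lemma lborel_integral_affine:
  fixes g :: "real^'n::{finite,wellorder} \<Rightarrow> real^'n::_" and f :: "real^'n::{finite,wellorder} \<Rightarrow> 'b::{banach,second_countable_topology}"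
  assumes g: "linear g" "inj g" and f: "f \<in> borel_measurable borel"
  shows "(\<integral>x. f x \<partial>lborel) = \<bar>det (matrix g)\<bar> *\<^sub>R (\<integral>x. f (p + g x) \<partial>lborel)"
proof -
  have gm: "g \<in> borel_measurable borel"
    by (intro borel_measurable_continuous_onI linear_continuous_on linear_conv_bounded_linear[THEN iffD1] g)
  have pm: "(\<lambda>x. f (p + x)) \<in> borel_measurable borel"
    using f by measurable
  have "(\<integral>x. f x \<partial>lborel) = (\<integral>x. f x \<partial>distr lborel borel ((+) p))"
    by (simp add: lborel_distr_plus)
  also have "\<dots> = (\<integral>x. f (p + x) \<partial>lborel)"
    using f by (subst integral_distr) auto
  also have "\<dots> = (\<integral>x. f (p + x) \<partial>density (distr lborel borel g) (\<lambda>_. ennreal \<bar>det (matrix g)\<bar>))"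
    by (simp add: density_distr_lborel_linear[OF g])
  also have "\<dots> = \<bar>det (matrix g)\<bar> *\<^sub>R (\<integral>x. f (p + g x) \<partial>lborel)"
    using gm pm by (simp add: integral_density integral_distr)
  finally show ?thesis .
qed

text \<open>Fubini for products of one-variable functions: \<open>lborel\<close> is the image of the
  product of one-dimensional Lebesgue measures under the coordinate map \<open>?T\<close>.\<close>

lemma has_bochner_integral_prod_Basis:
  fixes f :: "'a::euclidean_space \<Rightarrow> real \<Rightarrow> complex"
  assumes "\<And>b. b \<in> Basis \<Longrightarrow> has_bochner_integral lborel (f b) (I b)"
  shows "has_bochner_integral lborel (\<lambda>x. \<Prod>b\<in>Basis. f b (x \<bullet> b)) (\<Prod>b\<in>Basis. I b)"
proof -
  interpret product_sigma_finite "\<lambda>_::'a. lborel :: real measure" ..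
  have int: "integrable lborel (f b)" if "b \<in> Basis" for b
    using assms[OF that] by (simp add: has_bochner_integral_iff)
  let ?M = "\<Pi>\<^sub>M b\<in>Basis. (lborel :: real measure)" and ?T = "\<lambda>y. \<Sum>b\<in>Basis. y b *\<^sub>R (b::'a)"
  have "has_bochner_integral ?M (\<lambda>y. \<Prod>b\<in>Basis. f b (y b)) (\<Prod>b\<in>Basis. I b)"
    using product_integrable_prod[OF finite_Basis int] product_integral_prod[OF finite_Basis int] assms
    by (simp add: has_bochner_integral_iff)
  also have "(\<lambda>y. \<Prod>b\<in>Basis. f b (y b)) = (\<lambda>y. \<Prod>b\<in>Basis. f b (?T y \<bullet> b))"
    by (auto intro!: prod.cong simp: inner_sum_left inner_Basis if_distrib cong: if_cong)
  finally have "has_bochner_integral ?M (\<lambda>y. \<Prod>b\<in>Basis. f b (?T y \<bullet> b)) (\<Prod>b\<in>Basis. I b)" .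
  moreover have "(\<lambda>x. \<Prod>b\<in>Basis. f b (x \<bullet> b)) \<in> borel_measurable borel"
  proof (intro borel_measurable_prod)
    fix b :: 'a assume "b \<in> Basis"
    then have "f b \<in> borel_measurable borel" using int borel_measurable_integrable by fastforce
    then show "(\<lambda>x. f b (x \<bullet> b)) \<in> borel_measurable borel" by measurable
  qed
  moreover have "?T \<in> ?M \<rightarrow>\<^sub>M borel" by measurable
  ultimately have "has_bochner_integral (distr ?M borel ?T) (\<lambda>x. \<Prod>b\<in>Basis. f b (x \<bullet> b)) (\<Prod>b\<in>Basis. I b)"
    by (subst has_bochner_integral_distr) auto
  then show ?thesis by (simp add: lborel_eq[where 'a='a, symmetric])
qed

section \<open>Laplace transforms of the half-line and the quadrant\<close>

lemma set_integrable_exp_Ioi: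
  assumes "c > 0"
  shows "set_integrable lborel {0<..} (\<lambda>t::real. exp (- c * t))"
proof -
  have "set_integrable lborel (einterval 0 \<infinity>) (\<lambda>t::real. exp (- c * t))"
  proof (rule interval_integral_FTC_nonneg(1)[where F = "\<lambda>t. - exp (- c * t) / c"])
    show "((\<lambda>t. - exp (- c * t) / c) has_real_derivative exp (- c * x)) (at x)" for x
      using assms by (auto intro!: derivative_eq_intros)
    have "((\<lambda>t. - exp (- c * t) / c) \<longlongrightarrow> - exp (- c * 0) / c) (at_right 0)"
      by (intro tendsto_intros) (use assms in auto)
    then show "(((\<lambda>t. - exp (- c * t) / c) \<circ> real_of_ereal) \<longlongrightarrow> - exp (- c * 0) / c) (at_right 0)"
      by (simp add: zero_ereal_def ereal_tendsto_simps)
    have "((\<lambda>t. - exp (- c * t) / c) \<longlongrightarrow> - 0 / c) at_top"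
      using assms
      by (intro tendsto_intros filterlim_compose[OF exp_at_bot] filterlim_tendsto_neg_mult_at_bot[OF tendsto_const])
        (auto simp: filterlim_ident)
    then show "(((\<lambda>t. - exp (- c * t) / c) \<circ> real_of_ereal) \<longlongrightarrow> 0) (at_left \<infinity>)"
      by (simp add: ereal_tendsto_simps)
  qed auto
  then show ?thesis by (simp add: zero_ereal_def)
qed

text \<open>The modulus of the integrand is the real exponential with rate
  \<open>Re \<alpha>\<close>, which gives integrability; the antiderivative \<open>?F\<close> tends
  to 0 at infinity and equals -1/\<alpha> at 0.\<close>

lemma has_bochner_integral_exp_Ioi:
  fixes \<alpha> :: complex
  assumes "Re \<alpha> > 0"
  shows "has_bochner_integral lborel (\<lambda>t. indicator {0<..} t *\<^sub>R exp (- \<alpha> * of_real t)) (1 / \<alpha>)"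
proof -
  let ?f = "\<lambda>t. exp (- \<alpha> * of_real t)" and ?F = "\<lambda>t. - exp (- \<alpha> * of_real t) / \<alpha>"
  have nz: "\<alpha> \<noteq> 0" using assms by auto
  have int: "set_integrable lborel {0<..} ?f"
    unfolding set_integrable_def
  proof (rule Bochner_Integration.integrable_bound[OF set_integrable_exp_Ioi[OF assms, unfolded set_integrable_def]])
    show "AE x in lborel. norm (indicat_real {0<..} x *\<^sub>R ?f x)
        \<le> norm (indicat_real {0<..} x *\<^sub>R exp (- Re \<alpha> * x))"
      by simp
  qed measurable
  have "(LBINT x=0..\<infinity>. ?f x) = 0 - (- 1 / \<alpha>)"
  proof (rule interval_integral_FTC_integrable)
    show "(?F has_vector_derivative ?f x) (at x)" for x
    proof -
      have "((\<lambda>z. - exp (- \<alpha> * z) / \<alpha>) has_field_derivative ?f x) (at (of_real x))"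
        using nz by (auto intro!: derivative_eq_intros)
      from has_vector_derivative_real_field[OF this] show ?thesis by simp
    qed
    show "isCont ?f x" for x by (intro continuous_intros)
    show "set_integrable lborel (einterval 0 \<infinity>) ?f" using int by (simp add: zero_ereal_def)
    have "(?F \<longlongrightarrow> - exp (- \<alpha> * of_real 0) / \<alpha>) (at_right 0)"
      by (intro tendsto_intros) (use nz in auto)
    then show "((?F \<circ> real_of_ereal) \<longlongrightarrow> - 1 / \<alpha>) (at_right 0)"
      by (simp add: zero_ereal_def ereal_tendsto_simps)
    have "((\<lambda>t. exp (- Re \<alpha> * t) / norm \<alpha>) \<longlongrightarrow> 0 / norm \<alpha>) at_top"
      using assms nz
      by (intro tendsto_intros filterlim_compose[OF exp_at_bot] filterlim_tendsto_neg_mult_at_bot[OF tendsto_const])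
        (auto simp: filterlim_ident)
    then have "(?F \<longlongrightarrow> 0) at_top"
      by (subst tendsto_norm_zero_iff[symmetric]) (simp add: norm_divide)
    then show "((?F \<circ> real_of_ereal) \<longlongrightarrow> 0) (at_left \<infinity>)"
      by (simp add: ereal_tendsto_simps)
  qed auto
  then have "(LBINT x:{0<..}. ?f x) = 1 / \<alpha>"
    by (simp add: interval_lebesgue_integral_def zero_ereal_def)
  then show ?thesis
    using int by (simp add: has_bochner_integral_iff set_integrable_def set_lebesgue_integral_def)
qed

lemma has_bochner_integral_exp_quadrant:
  fixes \<alpha> \<beta> :: complex
  assumes "Re \<alpha> > 0" "Re \<beta> > 0"
  shows "has_bochner_integral lborel
    (\<lambda>y::real^2. indicator {y. y $ 1 > 0 \<and> y $ 2 > 0} y *\<^sub>R exp (- \<alpha> * of_real (y $ 1) - \<beta> * of_real (y $ 2)))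
    (1 / (\<alpha> * \<beta>))"
proof -
  \<comment> \<open>The products range over basis vectors rather than indices, so the rates \<alpha>
    and \<beta> are attached to the two vectors.\<close>
  define f :: "real^2 \<Rightarrow> complex" where "f b = (if b = axis 1 1 then \<alpha> else \<beta>)" for b
  let ?g = "\<lambda>b t. indicator {0<..} t *\<^sub>R exp (- f b * of_real t)"
  have B: "(Basis :: (real^2) set) = {axis 1 1, axis 2 1}"
    by (auto simp: Basis_vec_def UNIV_2)
  have ne: "axis 1 1 \<noteq> (axis 2 1 :: real^2)"
    by (simp add: axis_eq_axis)
  have "has_bochner_integral lborel (\<lambda>y::real^2. \<Prod>b\<in>Basis. ?g b (y \<bullet> b)) (\<Prod>b\<in>Basis. 1 / f b)"
    using assms by (intro has_bochner_integral_prod_Basis has_bochner_integral_exp_Ioi) (auto simp: f_def)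
  moreover have "(\<Prod>b\<in>Basis. 1 / f b) = 1 / (\<alpha> * \<beta>)"
    using ne ne[symmetric] by (simp add: B f_def)
  moreover have "(\<Prod>b\<in>Basis. ?g b (y \<bullet> b))
      = indicator {y. y $ 1 > 0 \<and> y $ 2 > 0} y *\<^sub>R exp (- \<alpha> * of_real (y $ 1) - \<beta> * of_real (y $ 2))" for y :: "real^2"
    using ne ne[symmetric] by (simp add: B f_def inner_axis exp_diff exp_minus field_simps split: split_indicator)
  ultimately show ?thesis by simp
qed

subsection \<open>The corner\<close>

text \<open>Contracting \<open>x\<close> towards \<open>p\<close> stays in \<open>D\<close> and
  reaches the ball, where the cone is known; a cone with apex \<open>p\<close> is invariant under
  expanding back.\<close>

lemma open_convex_subset_cone:
  fixes p :: "'a::euclidean_space"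
  assumes D: "open D" "convex D" "p \<in> frontier D" and r: "r > 0"
    and cone: "D \<inter> ball p r \<subseteq> {p + s *\<^sub>R a + t *\<^sub>R b |s t. s > 0 \<and> t > 0}"
    and x: "x \<in> D"
  obtains s t where "s > 0" "t > 0" "x = p + s *\<^sub>R a + t *\<^sub>R b"
proof -
  \<comment> \<open>Contraction by this factor lands within r/2 of \<open>p\<close>. The summand 1
    keeps the denominator positive, and the minimum keeps the contracted point on the segment from
    \<open>p\<close> to \<open>x\<close>.\<close>
  define \<epsilon> where "\<epsilon> = min 1 (r / (2 * (norm (x - p) + 1)))"
  have n: "norm (x - p) + 1 > 0" by (simp add: add_nonneg_pos)
  have \<epsilon>: "0 < \<epsilon>" "\<epsilon> \<le> 1" using r n by (auto simp: \<epsilon>_def)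
  have "\<epsilon> * norm (x - p) \<le> r / (2 * (norm (x - p) + 1)) * (norm (x - p) + 1)"
    by (intro mult_mono) (use r n in \<open>auto simp: \<epsilon>_def\<close>)
  also have "\<dots> = r / 2" using n by (simp add: field_simps)
  finally have "\<epsilon> * norm (x - p) < r" using r by simp
  then have "p - \<epsilon> *\<^sub>R (p - x) \<in> ball p r"
    using \<epsilon> by (simp add: dist_norm norm_minus_commute)
  moreover have "p - \<epsilon> *\<^sub>R (p - x) \<in> D"
    using mem_interior_closure_convex_shrink[of D x p \<epsilon>] D x \<epsilon> by (auto simp: interior_open frontier_def)
  ultimately obtain s t where st: "s > 0" "t > 0" "p - \<epsilon> *\<^sub>R (p - x) = p + s *\<^sub>R a + t *\<^sub>R b"
    using cone by blast
  have "\<epsilon> *\<^sub>R (x - p) = s *\<^sub>R a + t *\<^sub>R b"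
    using st(3) by (simp add: algebra_simps)
  then have "(1 / \<epsilon>) *\<^sub>R (\<epsilon> *\<^sub>R (x - p)) = (1 / \<epsilon>) *\<^sub>R (s *\<^sub>R a + t *\<^sub>R b)"
    by (rule arg_cong)
  then have "x = p + (s / \<epsilon>) *\<^sub>R a + (t / \<epsilon>) *\<^sub>R b"
    using \<epsilon> by (simp add: algebra_simps)
  then show thesis using that[of "s / \<epsilon>" "t / \<epsilon>"] st(1,2) \<epsilon> by simp
qed

text \<open>The condition on \<open>\<zeta>\<close> makes the exponential solve the interior
  equation, so it may be tested against \<open>u\<close>; the constant k^2 (1 - q) on the right is
  nonzero and cancels.\<close>

lemma nonscattering_orthogonality:
  assumes ns: "nonscattering k q D uin" and D: "open D" "bounded D"
    and k: "k \<noteq> 0" and q: "q \<noteq> 1" and uin: "continuous_on UNIV uin"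
    and \<zeta>: "bounded_linear \<zeta>" "(\<Sum>b\<in>Basis. (\<zeta> b)\<^sup>2) = - of_real (k\<^sup>2 * q)"
  shows "(\<integral>x. exp (\<zeta> (x - p)) * (uin x * indicator D x) \<partial>lborel) = 0"
proof -
  obtain u Lu where u: "AE x in lebesgue. x \<notin> D \<longrightarrow> u x = 0" "has_weak_laplacian u Lu"
    and eq: "AE x in lebesgue. Lu x + of_real (k\<^sup>2 * q) * u x = of_real (k\<^sup>2 * (1 - q)) * uin x * indicator D x"
    using ns unfolding nonscattering_def by blast
  let ?c = "of_real (k\<^sup>2 * (1 - q)) :: complex" and ?f = "\<lambda>x. exp (\<zeta> (x - p)) * (uin x * indicator D x)"
  have c: "?c \<noteq> 0" using k q by (simp only: of_real_eq_0_iff) simp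
  have "has_bochner_integral lebesgue (\<lambda>x. exp (\<zeta> (x - p)) * (?c * uin x * indicator D x)) 0"
    by (rule integral_helmholtz[OF D u(2,1) eq])
      (auto intro!: continuous_intros uin smooth_exp_affine \<zeta>(1) simp: laplacian_exp_affine[OF \<zeta>(1)] \<zeta>(2))
  then have "(\<integral>x. ?c * ?f x \<partial>lebesgue) = 0"
    by (simp add: has_bochner_integral_iff mult_ac)
  then have "(\<integral>x. ?f x \<partial>lebesgue) = 0"
    unfolding integral_mult_right_zero using c by simp
  \<comment> \<open>Borel measurability allows the passage to \<open>lborel\<close>, where the
    linear substitution is available.\<close>
  moreover have "?f \<in> borel_measurable lborel"
    using D(1) uin smooth_imp_continuous[OF smooth_exp_affine[OF \<zeta>(1)]]
    by (intro borel_measurable_times borel_measurable_indicator')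
      (auto intro: borel_measurable_continuous_onI)
  ultimately show ?thesis by (simp add: integral_completion)
qed

text \<open>The bilinear square of -s d + i t e: orthogonality kills the mixed term, and i^2 gives
  the minus sign.\<close>

lemma sum_Basis_Complex_square:
  fixes d e :: "'a::euclidean_space"
  assumes "d \<bullet> d = 1" "e \<bullet> e = 1" "d \<bullet> e = 0"
  shows "(\<Sum>b\<in>Basis. (Complex (- (s * (d \<bullet> b))) (t * (e \<bullet> b)))\<^sup>2) = of_real (s\<^sup>2 - t\<^sup>2)"
proof -
  have "(\<Sum>b\<in>Basis. s\<^sup>2 * ((d \<bullet> b) * (d \<bullet> b)) - t\<^sup>2 * ((e \<bullet> b) * (e \<bullet> b))) = s\<^sup>2 - t\<^sup>2"
    using assms euclidean_inner[of d d] euclidean_inner[of e e]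
    by (simp add: sum_subtractf flip: sum_distrib_left)
  moreover have "(\<Sum>b\<in>Basis. (d \<bullet> b) * (e \<bullet> b)) = 0"
    using assms euclidean_inner[of d e] by simp
  then have "(\<Sum>b\<in>Basis. - 2 * s * t * ((d \<bullet> b) * (e \<bullet> b))) = 0"
    by (simp only: sum_distrib_left[symmetric] mult_zero_right)
  ultimately show ?thesis
    by (simp add: complex_eq_iff power2_eq_square algebra_simps)
qed

text \<open>The blow-up at the corner: \<open>d\<close> is the direction of decay, \<open>e\<close>
  that of oscillation. After the substitution x = p + T y / \<open>Suc n\<close> the exponentials
  converge because \<open>\<sigma> n / real (Suc n)\<close> tends to 1, and dominated convergence
  yields a nonzero multiple of \<open>g p\<close>.\<close>

lemma corner_laplace_transform_zero:
  fixes a b p :: "real^2" and g :: "real^2 \<Rightarrow> complex"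
  assumes D: "open D" "bounded D" and r: "r > 0"
    and cone: "D \<inter> ball p r = {p + s *\<^sub>R a + t *\<^sub>R b |s t. s > 0 \<and> t > 0} \<inter> ball p r"
    and D_cone: "\<And>x. x \<in> D \<Longrightarrow> \<exists>s>0. \<exists>t>0. x = p + s *\<^sub>R a + t *\<^sub>R b"
    and cs: "c > 0" "s \<noteq> 0"
    and d: "d \<bullet> a = c" "d \<bullet> b = c" and e: "e \<bullet> a = - s" "e \<bullet> b = s"
    and \<sigma>: "(\<lambda>n. \<sigma> n / real (Suc n)) \<longlonglongrightarrow> 1"
    and g: "continuous_on UNIV g"
    and zero: "\<And>n. (\<integral>x. exp (Complex (- (real (Suc n) * (d \<bullet> (x - p)))) (\<sigma> n * (e \<bullet> (x - p))))
        * (g x * indicator D x) \<partial>lborel) = 0"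
  shows "g p = 0"
proof -
  \<comment> \<open>\<open>T\<close> carries the quadrant \<open>Q\<close> onto the cone translated
    to the origin.\<close>
  define T :: "real^2 \<Rightarrow> real^2" where "T y = (y $ 1) *\<^sub>R a + (y $ 2) *\<^sub>R b" for y
  define Q :: "(real^2) set" where "Q = {y. y $ 1 > 0 \<and> y $ 2 > 0}"
  \<comment> \<open>These are the rates of the limiting exponential along the edges: the exponent of
    \<open>?E\<close> is -d \<bullet> T y + i (e \<bullet> T y).\<close>
  define \<alpha> \<beta> where "\<alpha> = Complex c s" and "\<beta> = Complex c (- s)"
  let ?E = "\<lambda>y::real^2. exp (- \<alpha> * of_real (y $ 1) - \<beta> * of_real (y $ 2))"
  let ?F = "\<lambda>n x. exp (Complex (- (real (Suc n) * (d \<bullet> (x - p)))) (\<sigma> n * (e \<bullet> (x - p)))) * (g x * indicator D x)"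
  let ?x = "\<lambda>n y. p + (1 / real (Suc n)) *\<^sub>R T y"
  have dT: "d \<bullet> T y = c * (y $ 1 + y $ 2)" and eT: "e \<bullet> T y = s * (y $ 2 - y $ 1)" for y
    by (simp_all add: T_def inner_add_right d e algebra_simps)
  have linT: "linear T"
    by (rule linearI) (simp_all add: T_def algebra_simps)
  \<comment> \<open>Pairing with \<open>d\<close> and \<open>e\<close> recovers the sum and the
    difference of the coordinates, as \<open>c\<close> and \<open>s\<close> are nonzero.\<close>
  have injT: "y = z" if "T y = T z" for y z
  proof -
    have "y $ 1 + y $ 2 = z $ 1 + z $ 2" "y $ 2 - y $ 1 = z $ 2 - z $ 1"
      using dT[of y] dT[of z] eT[of y] eT[of z] that cs by auto
    then have "y $ 1 = z $ 1 \<and> y $ 2 = z $ 2" by linarith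
    then show ?thesis by (simp add: vec_eq_iff forall_2)
  qed
  have lin: "linear (\<lambda>y. (1 / real (Suc n)) *\<^sub>R T y)" for n
    by (intro linear_compose_scale_right linT)
  have inj: "inj (\<lambda>y. (1 / real (Suc n)) *\<^sub>R T y)" for n
    using injT by (auto simp: inj_def)
  have exp_meas: "(\<lambda>x. exp (Complex (- (real (Suc n) * (d \<bullet> (x - p)))) (\<sigma> n * (e \<bullet> (x - p)))))
      \<in> borel_measurable borel" for n
    unfolding Complex_eq by (intro borel_measurable_continuous_onI continuous_intros)
  have F_meas: "?F n \<in> borel_measurable borel" for n
    using D(1) g by (intro borel_measurable_times exp_meas borel_measurable_indicator')
      (auto intro: borel_measurable_continuous_onI)
  \<comment> \<open>The Jacobian is nonzero, so the vanishing survives the substitution.\<close>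
  have zero': "(\<integral>y. ?F n (?x n y) \<partial>lborel) = 0" for n
  proof -
    have "det (matrix (\<lambda>y. (1 / real (Suc n)) *\<^sub>R T y)) \<noteq> 0"
      using det_nz_iff_inj[OF lin] inj by blast
    then show ?thesis
      using lborel_integral_affine[OF lin inj F_meas, of n n p] zero[of n] by simp
  qed
  have F_x: "?F n (?x n y) = exp (Complex (- (c * (y $ 1 + y $ 2))) (\<sigma> n / real (Suc n) * (s * (y $ 2 - y $ 1))))
      * (g (?x n y) * indicator D (?x n y))" for n y
    by (simp add: dT eT del: of_nat_Suc)
  have E_eq: "?E y = exp (Complex (- (c * (y $ 1 + y $ 2))) (1 * (s * (y $ 2 - y $ 1))))" for y
    by (rule arg_cong[of _ _ exp]) (simp add: \<alpha>_def \<beta>_def complex_eq_iff algebra_simps)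
  \<comment> \<open>Cone coordinates are unique by \<open>injT\<close>; the positive ones from
    \<open>D_cone\<close> are therefore those of \<open>y\<close>, rescaled.\<close>
  have x_Q: "y \<in> Q" if x: "?x n y \<in> D" for n y
  proof -
    obtain s' t' where st: "s' > 0" "t' > 0" "?x n y = p + s' *\<^sub>R a + t' *\<^sub>R b"
      using D_cone[OF x] by blast
    define z :: "real^2" where "z = (\<chi> i. if i = 1 then s' else t')"
    have "(1 / real (Suc n)) *\<^sub>R T y = T z"
      using st(3) by (simp add: T_def z_def algebra_simps)
    then have "T ((1 / real (Suc n)) *\<^sub>R y) = T z"
      using linear_scale[OF linT] by simp
    from injT[OF this] have "(1 / real (Suc n)) * y $ 1 = s'" "(1 / real (Suc n)) * y $ 2 = t'"
      by (auto simp: z_def vec_eq_iff forall_2)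
    then show ?thesis
      using st by (auto simp: Q_def zero_less_divide_iff simp del: of_nat_Suc)
  qed
  have "bounded (g ` D)"
    using compact_imp_bounded[OF compact_continuous_image[OF continuous_on_subset[OF g]], of "closure D"] D(2)
    by (simp add: bounded_subset[OF _ image_mono[OF closure_subset]])
  then obtain M where "M > 0" and M: "\<And>x. x \<in> D \<Longrightarrow> norm (g x) \<le> M"
    by (auto simp: bounded_pos)
  \<comment> \<open>The modulus of the exponential sees only the real part of the exponent, which
    after rescaling is the same for all \<open>n\<close>; the bound is thus uniform.\<close>
  have M0: "norm (?F n (?x n y)) \<le> M * norm (indicator Q y *\<^sub>R ?E y)" for n y
  proof (cases "?x n y \<in> D")
    case True
    then have "y \<in> Q" by (rule x_Q)
    with True M[OF True] show ?thesis
      unfolding F_x E_eq by (simp add: norm_mult mult.commute mult_right_mono)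
  next
    case False
    then show ?thesis using \<open>M > 0\<close> unfolding F_x by simp
  qed
  have \<alpha>\<beta>: "Re \<alpha> > 0" "Re \<beta> > 0" "\<alpha> \<noteq> 0" "\<beta> \<noteq> 0" using cs by (auto simp: \<alpha>_def \<beta>_def complex_eq_iff)
  have I: "has_bochner_integral lborel (\<lambda>y. indicator Q y *\<^sub>R ?E y) (1 / (\<alpha> * \<beta>))"
    unfolding Q_def by (rule has_bochner_integral_exp_quadrant[OF \<alpha>\<beta>(1,2)])
  \<comment> \<open>Off \<open>Q\<close> all terms are 0 by \<open>x_Q\<close>. On \<open>Q\<close>
    the points run into \<open>p\<close> inside the cone, hence eventually lie in \<open>D\<close>,
    because \<open>D\<close> fills the cone near \<open>p\<close>.\<close>
  have lim: "(\<lambda>n. ?F n (?x n y)) \<longlonglongrightarrow> indicator Q y *\<^sub>R ?E y * g p" for y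
  proof (cases "y \<in> Q")
    case False
    then have "?x n y \<notin> D" for n using x_Q by blast
    then show ?thesis using False by simp
  next
    case True
    have "(\<lambda>n. ?x n y) \<longlonglongrightarrow> p + 0 *\<^sub>R T y"
      by (intro tendsto_intros LIMSEQ_Suc lim_1_over_n)
    then have x: "(\<lambda>n. ?x n y) \<longlonglongrightarrow> p" by simp
    have "\<forall>\<^sub>F n in sequentially. ?x n y \<in> ball p r"
      using topological_tendstoD[OF x open_ball, of p r] r by simp
    then have "\<forall>\<^sub>F n in sequentially. indicator D (?x n y) = (1 :: complex)"
    proof eventually_elim
      case (elim n)
      have "?x n y = p + (y $ 1 / real (Suc n)) *\<^sub>R a + (y $ 2 / real (Suc n)) *\<^sub>R b"
        by (simp add: T_def algebra_simps)
      moreover have "y $ 1 / real (Suc n) > 0" "y $ 2 / real (Suc n) > 0"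
        using True by (auto simp: Q_def)
      ultimately have "?x n y \<in> D" using elim cone by blast
      then show ?case by simp
    qed
    then have ind: "(\<lambda>n. indicator D (?x n y) :: complex) \<longlonglongrightarrow> 1"
      by (rule tendsto_eventually)
    have "(\<lambda>n. g (?x n y)) \<longlonglongrightarrow> g p"
      using continuous_on_tendsto_compose[OF g x] by simp
    then have "(\<lambda>n. ?F n (?x n y)) \<longlonglongrightarrow> ?E y * (g p * 1)"
      unfolding F_x E_eq by (intro tendsto_intros \<sigma> ind)
    then show ?thesis using True by simp
  qed
  have "(\<lambda>n. \<integral>y. ?F n (?x n y) \<partial>lborel) \<longlonglongrightarrow> (\<integral>y. indicator Q y *\<^sub>R ?E y * g p \<partial>lborel)"
  proof (rule integral_dominated_convergence)
    show "integrable lborel (\<lambda>y. M * norm (indicator Q y *\<^sub>R ?E y))"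
      using I by (intro integrable_mult_right integrable_norm) (simp add: has_bochner_integral_iff)
    show "(\<lambda>y. indicator Q y *\<^sub>R ?E y * g p) \<in> borel_measurable lborel"
      using I by (intro borel_measurable_times borel_measurable_const borel_measurable_integrable)
        (simp add: has_bochner_integral_iff)
    have "T \<in> borel_measurable borel"
      by (intro borel_measurable_continuous_onI linear_continuous_on linear_conv_bounded_linear[THEN iffD1] linT)
    then have "?x n \<in> borel_measurable borel" for n by measurable
    then show "(\<lambda>y. ?F n (?x n y)) \<in> borel_measurable lborel" for n
      unfolding measurable_lborel2 by (rule measurable_compose[OF _ F_meas])
  qed (use lim M0 in auto)
  then have "(\<integral>y. indicator Q y *\<^sub>R ?E y * g p \<partial>lborel) = 0"
    unfolding zero' by (simp add: LIMSEQ_const_iff)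
  moreover have "(\<integral>y. indicator Q y *\<^sub>R ?E y * g p \<partial>lborel) = 1 / (\<alpha> * \<beta>) * g p"
    using has_bochner_integral_mult_left[OF I, of "g p"] by (simp add: has_bochner_integral_iff)
  ultimately show ?thesis using \<alpha>\<beta> by simp
qed

theorem corollary3p12:
  fixes k q :: real
    and D :: "(real^2) set"
    and p :: "real^2"
    and uin :: "real^2 \<Rightarrow> complex"
  assumes "k > 0"
    and "open D" and "bounded D" and "convex D"
    and "p \<in> frontier D"
    and "straight_corner_at D p"
    and "\<And>x. x \<in> frontier D \<Longrightarrow> x \<noteq> p \<Longrightarrow> smooth_boundary_at D x"
    and "0 < q" and "q \<noteq> 1"
    and "incident_wave k uin"
    and "uin p \<noteq> 0"
  shows "scattered k q D uin"
  unfolding scattered_def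
proof
  assume ns: "nonscattering k q D uin"
  obtain r \<theta> a b where r: "r > 0" and \<theta>: "0 < \<theta>" "\<theta> < pi / 2"
    and ab: "norm a = 1" "norm b = 1" "a \<bullet> b = cos (2 * \<theta>)"
    and cone: "D \<inter> ball p r = {p + s *\<^sub>R a + t *\<^sub>R b |s t. s > 0 \<and> t > 0} \<inter> ball p r"
    using assms(6) unfolding straight_corner_at_def greaterThanLessThan_iff Bex_def
    by (elim exE conjE) (rule that; assumption)
  \<comment> \<open>The cosine is the decay rate along both edges; positivity of the sine makes the
    edge vectors independent.\<close>
  have c: "cos \<theta> > 0" and s: "sin \<theta> > 0"
    using \<theta> by (auto intro: cos_gt_zero sin_gt_zero)
  have inner: "a \<bullet> a = 1" "b \<bullet> b = 1" "b \<bullet> a = a \<bullet> b"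
    using ab by (auto simp: norm_eq_1 inner_commute)
  have abc: "a \<bullet> b = 2 * (cos \<theta>)\<^sup>2 - 1"
    by (simp only: ab cos_double_cos)
  have abs: "a \<bullet> b = 1 - 2 * (sin \<theta>)\<^sup>2"
    by (simp only: ab cos_double_sin)
  \<comment> \<open>The unit bisector and the unit vector orthogonal to it: |a + b| = 2 cos \<theta>
    and |b - a| = 2 sin \<theta>.\<close>
  define d e where "d = (1 / (2 * cos \<theta>)) *\<^sub>R (a + b)" and "e = (1 / (2 * sin \<theta>)) *\<^sub>R (b - a)"
  have d: "d \<bullet> a = cos \<theta>" "d \<bullet> b = cos \<theta>"
    using c by (simp_all add: d_def inner_add_left inner abc field_simps power2_eq_square)
  have e: "e \<bullet> a = - sin \<theta>" "e \<bullet> b = sin \<theta>"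
    using s by (simp_all add: e_def inner_diff_left inner abs field_simps power2_eq_square)
  have orth: "d \<bullet> d = 1" "e \<bullet> e = 1" "d \<bullet> e = 0"
  proof -
    show "d \<bullet> d = 1" using c d by (subst (2) d_def) (simp add: inner_add_right)
    show "e \<bullet> e = 1" using s e by (subst (2) e_def) (simp add: inner_diff_right)
    show "d \<bullet> e = 0" using d by (subst e_def) (simp add: inner_diff_right)
  qed
  \<comment> \<open>Chosen so that (Suc n)^2 - \<sigma>^2 = -k^2 q, the interior Helmholtz
    condition; \<open>Suc n\<close> keeps the decay rate positive for every
    \<open>n\<close>.\<close>
  define \<sigma> where "\<sigma> n = sqrt ((real (Suc n))\<^sup>2 + k\<^sup>2 * q)" for n
  have \<sigma>2: "(\<sigma> n)\<^sup>2 = (real (Suc n))\<^sup>2 + k\<^sup>2 * q" for n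
    using assms by (simp add: \<sigma>_def)
  have \<sigma>: "(\<lambda>n. \<sigma> n / real (Suc n)) \<longlonglongrightarrow> 1"
  proof -
    have "(\<lambda>n. sqrt (1 + k\<^sup>2 * q * (1 / real (Suc n)) * (1 / real (Suc n)))) \<longlonglongrightarrow> sqrt (1 + k\<^sup>2 * q * 0 * 0)"
      by (intro tendsto_intros LIMSEQ_Suc lim_1_over_n)
    also have "(\<lambda>n. sqrt (1 + k\<^sup>2 * q * (1 / real (Suc n)) * (1 / real (Suc n)))) = (\<lambda>n. \<sigma> n / real (Suc n))"
    proof
      fix n
      have "\<sigma> n / real (Suc n) = sqrt (((real (Suc n))\<^sup>2 + k\<^sup>2 * q) / (real (Suc n))\<^sup>2)"
        by (simp add: \<sigma>_def real_sqrt_divide del: of_nat_Suc)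
      also have "((real (Suc n))\<^sup>2 + k\<^sup>2 * q) / (real (Suc n))\<^sup>2 = 1 + k\<^sup>2 * q * (1 / real (Suc n)) * (1 / real (Suc n))"
        by (simp add: field_simps power2_eq_square del: of_nat_Suc)
      finally show "sqrt (1 + k\<^sup>2 * q * (1 / real (Suc n)) * (1 / real (Suc n))) = \<sigma> n / real (Suc n)" by simp
    qed
    finally show ?thesis by simp
  qed
  have cone_sub: "D \<inter> ball p r \<subseteq> {p + s *\<^sub>R a + t *\<^sub>R b |s t. s > 0 \<and> t > 0}"
    unfolding cone by (rule Int_lower1)
  have uin: "continuous_on UNIV uin"
    using assms(10) C_k_imp_continuous by (auto simp: incident_wave_def simp del: C_k.simps)
  have "uin p = 0"
  proof (rule corner_laplace_transform_zero[OF assms(2,3) r cone _ c _ d e \<sigma> uin])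
    \<comment> \<open>Convexity turns the local description of the corner into a global inclusion,
      so the exponentials decay on all of \<open>D\<close>.\<close>
    show "\<exists>s>0. \<exists>t>0. x = p + s *\<^sub>R a + t *\<^sub>R b" if "x \<in> D" for x
      by (rule open_convex_subset_cone[OF assms(2,4,5) r cone_sub that]) blast
    fix n
    let ?\<zeta> = "\<lambda>x. Complex (- (real (Suc n) * (d \<bullet> x))) (\<sigma> n * (e \<bullet> x))"
    have lin: "bounded_linear ?\<zeta>"
      unfolding linear_conv_bounded_linear[symmetric]
      by (rule linearI) (simp_all add: complex_eq_iff algebra_simps)
    have "(\<Sum>b\<in>Basis. (?\<zeta> b)\<^sup>2) = - of_real (k\<^sup>2 * q)"
      unfolding sum_Basis_Complex_square[OF orth] \<sigma>2 by simp
    from nonscattering_orthogonality[OF ns assms(2,3) _ assms(9) uin lin this] assms(1)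
    show "(\<integral>x. exp (?\<zeta> (x - p)) * (uin x * indicator D x) \<partial>lborel) = 0" by simp
  qed (use s in simp)
  with assms(11) show False by simp
qed

end
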